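(* Let $w$ be an infinite prime of $F$, $K$ the completion of $F$ at $w$, and $\phi$ a Drinfeld $A$-module of rank $r$ over $K$ with associated lattice $\Lambda\subset\mathbb{C}_\infty$ and exponential function $e_\phi$. Let $\{\omega_i\}_{i=1,\ldots,r}$ be an SMB of $\Lambda$. Then for any finite prime $u$ of $A$ and any positive integer $n$, the family $\{e_\phi(\omega_i/u^n)\}_{i=1,\ldots,r}$ is an SMB of $\phi[u^n]$.
   Context: Let $q$ be a power of a prime $p$, $A=\mathbb{F}_q[t]$, $F$ a finite extension of $\mathbb{F}_q(t)$. An infinite prime of $F$ is one lying over the place $1/t$. For a prime $w$ of $F$, $K$ is the completion of $F$ at $w$, and $w$ also denotes the normalized valuation ($w(K^\times)=\mathbb{Z}$), extended to a separable closure $K^{\mathrm{sep}}$ and to the completion $\mathbb{C}_\infty$ of an algebraic closure. $|\cdot|$ is the absolute value on $\mathbb{C}_\infty$ extending $|a|=q^{\deg a}$ on $\mathbb{F}_q((1/t))$. A rank $r$ Drinfeld $A$-module $\phi$ over $K$ is an $\mathbb{F}_q$-algebra homomorphism $a\mapsto\phi_a$ into $\mathbb{F}_q$-linear polynomials over $K$ with $\phi_t(X)=tX+a_1X^q+\cdots+a_rX^{q^r}$, $a_r\neq 0$; write $a\cdot_\phi x=\phi_a(x)$. A finite prime $u$ of $A$ is a monic irreducible polynomial; $\phi[u^n]\subset K^{\mathrm{sep}}$ is the set of roots of $\phi_{u^n}(X)$, a free $A/u^n$-module of rank $r$. By uniformization there is an $A$-lattice $\Lambda\subset\mathbb{C}_\infty$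 (discrete free $A$-submodule of rank $r$, $A\subset\mathbb{C}_\infty$ acting by multiplication, stable under $\mathrm{Gal}(K^{\mathrm{sep}}/K)$) such that $e_\phi(z)=z\prod_{\mu\in\Lambda\setminus\{0\}}(1-z/\mu)$ is a surjective entire function $\mathbb{C}_\infty\to\mathbb{C}_\infty$ with kernel $\Lambda$ and $e_\phi(az)=\phi_a(e_\phi(z))$ for all $a\in A$. An SMB of $\Lambda$ is a family $\{\omega_i\}_{i=1}^r\subset\Lambda$ such that for each $i$, $\omega_1,\dots,\omega_i$ are $A$-linearly independent and $|\omega_i|$ is minimal among $|\omega|$ for $\omega\in\Lambda$ with $\omega_1,\dots,\omega_{i-1},\omega$ $A$-linearly independent. An SMB of $\phi[u^n]$ is a family $\{\lambda_i\}_{i=1}^r\subset\phi[u^n]$ such that for each $i$, $\lambda_1,\dots,\lambda_i$ are $A/u^n$-linearly independent and $w(\lambda_i)$ is the largest among the valuations $w(\lambda)$ of $\lambda\in\phi[u^n]$ with $\lambda_1,\dots,\lambda_{i-1},\lambda$ $A/u^n$-linearly independent. *)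

theory Defs
  imports "HOL-Analysis.Analysis" "HOL-Computational_Algebra.Polynomial"
begin

text \<open>
  Everything lives inside one field \<open>'c\<close>, playing the role of \<open>C\<^sub>\<infinity>\<close>:
  \<open>F\<^sub>q(t) \<subseteq> F \<subseteq> K \<subseteq> K\<^sup>s\<^sup>e\<^sup>p \<subseteq> C\<^sub>\<infinity>\<close>. The field \<open>F\<^sub>q\<close> is a finite field type \<open>'q\<close>,
  \<open>A = F\<^sub>q[t]\<close> is \<open>'q poly\<close> (with \<open>t = [:0, 1:]\<close>), and \<open>\<iota>\<close> is the inclusion of \<open>A\<close> in \<open>C\<^sub>\<infinity>\<close>.
  The absolute value on \<open>C\<^sub>\<infinity>\<close> is \<open>absv\<close>; the topology is the one it defines.
\<close>

class nonarch_field = field + metric_space +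
  fixes absv :: "'a \<Rightarrow> real"
  assumes dist_absv: "dist x y = absv (x - y)"
    and absv_mult: "absv (x * y) = absv x * absv y"
    and absv_add_le_max: "absv (x + y) \<le> max (absv x) (absv y)"

definition poly_over :: "'c::field set \<Rightarrow> 'c poly set" where
  "poly_over K = {p. \<forall>i. coeff p i \<in> K}"

definition is_subfield :: "'c::field set \<Rightarrow> bool" where
  "is_subfield S \<longleftrightarrow> 0 \<in> S \<and> 1 \<in> S \<and>
     (\<forall>x\<in>S. \<forall>y\<in>S. x + y \<in> S \<and> x * y \<in> S) \<and> (\<forall>x\<in>S. - x \<in> S \<and> inverse x \<in> S)"

text \<open>The last clause says that \<open>absv\<close> extends the absolute value \<open>q\<^bsup>deg a\<^esup>\<close>
  (by multiplicativity and continuity, on all of \<open>F\<^sub>q((1/t))\<close>, the closure of \<open>F\<^sub>q(t)\<close>).\<close>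

definition A_inclusion :: "('q::{field,finite} poly \<Rightarrow> 'c::nonarch_field) \<Rightarrow> bool" where
  "A_inclusion \<iota> \<longleftrightarrow> \<iota> 1 = 1 \<and>
     (\<forall>a b. \<iota> (a + b) = \<iota> a + \<iota> b) \<and> (\<forall>a b. \<iota> (a * b) = \<iota> a * \<iota> b) \<and>
     (\<forall>a. a \<noteq> 0 \<longrightarrow> absv (\<iota> a) = real CARD('q) ^ degree a)"

definition rational_functions :: "('q::field poly \<Rightarrow> 'c::field) \<Rightarrow> 'c set" where
  "rational_functions \<iota> = {\<iota> a / \<iota> b | a b. b \<noteq> 0}"

definition finite_extension_of_Fqt :: "('q::field poly \<Rightarrow> 'c::field) \<Rightarrow> 'c set \<Rightarrow> bool" where
  "finite_extension_of_Fqt \<iota> F \<longleftrightarrow> is_subfield F \<and> rational_functions \<iota> \<subseteq> F \<and>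
     (\<exists>B. finite B \<and> B \<subseteq> F \<and>
        (\<forall>x\<in>F. \<exists>c. (\<forall>b\<in>B. c b \<in> rational_functions \<iota>) \<and> x = (\<Sum>b\<in>B. c b * b)))"

definition normalized_valuation_on :: "'c::field set \<Rightarrow> ('c \<Rightarrow> ereal) \<Rightarrow> bool" where
  "normalized_valuation_on F w \<longleftrightarrow> w 0 = \<infinity> \<and>
     w ` (F - {0}) = range (\<lambda>k::int. ereal (of_int k)) \<and>
     (\<forall>x\<in>F. \<forall>y\<in>F. w (x * y) = w x + w y) \<and>
     (\<forall>x\<in>F. \<forall>y\<in>F. min (w x) (w y) \<le> w (x + y))"

text \<open>The place \<open>1/t\<close> of \<open>F\<^sub>q(t)\<close> is the valuation \<open>deg b - deg a\<close> of \<open>a/b\<close>; the integer \<open>d\<close>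
  below is the ramification index.\<close>

definition infinite_prime :: "('q::field poly \<Rightarrow> 'c::field) \<Rightarrow> 'c set \<Rightarrow> ('c \<Rightarrow> ereal) \<Rightarrow> bool" where
  "infinite_prime \<iota> F w \<longleftrightarrow> normalized_valuation_on F w \<and>
     (\<exists>d::int. d > 0 \<and> (\<forall>a b. a \<noteq> 0 \<longrightarrow> b \<noteq> 0 \<longrightarrow>
        w (\<iota> a / \<iota> b) = ereal (of_int (d * (int (degree b) - int (degree a))))))"

text \<open>\<open>w\<close> is a valuation on \<open>C\<^sub>\<infinity>\<close> belonging to the absolute value, \<open>absv x = c\<^bsup>- w x\<^esup>\<close>.
  The constant \<open>c\<close> is not prescribed: the scaling of \<open>w\<close> is fixed by its normalization on \<open>F\<close>.\<close>

definition valuation_of_absv :: "('c::nonarch_field \<Rightarrow> ereal) \<Rightarrow> bool" where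
  "valuation_of_absv w \<longleftrightarrow> w 0 = \<infinity> \<and>
     (\<exists>c>1. \<forall>x. x \<noteq> 0 \<longrightarrow> w x = ereal (- log c (absv x)))"

definition algebraic_over :: "'c::field set \<Rightarrow> 'c set" where
  "algebraic_over K = {x. \<exists>p\<in>poly_over K. p \<noteq> 0 \<and> poly p x = 0}"

text \<open>\<open>K\<^sup>s\<^sup>e\<^sup>p\<close>, the roots of separable polynomials over \<open>K\<close>.\<close>

definition separable_over :: "'c::field set \<Rightarrow> 'c set" where
  "separable_over K = {x. \<exists>p\<in>poly_over K. coprime p (pderiv p) \<and> poly p x = 0}"

text \<open>The complete field \<open>'c\<close> is the completion of an algebraic closure of \<open>K\<close>: the elements
  algebraic over \<open>K\<close> form an algebraically closed field which is dense in \<open>'c\<close>.\<close>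

definition completed_algebraic_closure :: "'c::{nonarch_field,complete_space} set \<Rightarrow> bool" where
  "completed_algebraic_closure K \<longleftrightarrow>
     (\<forall>p\<in>poly_over (algebraic_over K). degree p > 0 \<longrightarrow> (\<exists>x\<in>algebraic_over K. poly p x = 0)) \<and>
     closure (algebraic_over K) = UNIV"

text \<open>Only the restriction of \<open>\<sigma>\<close> to \<open>K\<^sup>s\<^sup>e\<^sup>p\<close> matters here.\<close>

definition galois_automorphism :: "'c::field set \<Rightarrow> ('c \<Rightarrow> 'c) \<Rightarrow> bool" where
  "galois_automorphism K \<sigma> \<longleftrightarrow>
     bij_betw \<sigma> (separable_over K) (separable_over K) \<and>
     (\<forall>x\<in>separable_over K. \<forall>y\<in>separable_over K.
        \<sigma> (x + y) = \<sigma> x + \<sigma> y \<and> \<sigma> (x * y) = \<sigma> x * \<sigma> y) \<and>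
     (\<forall>x\<in>K. \<sigma> x = x)"

text \<open>\<open>Gal(K\<^sup>s\<^sup>e\<^sup>p/K)\<close> acts on \<open>C\<^sub>\<infinity>\<close> by continuity: the action of an automorphism is
  its continuous extension from the dense subfield \<open>K\<^sup>s\<^sup>e\<^sup>p\<close> to \<open>C\<^sub>\<infinity>\<close>.\<close>

definition galois_stable :: "'c::nonarch_field set \<Rightarrow> 'c set \<Rightarrow> bool" where
  "galois_stable K L \<longleftrightarrow>
     (\<forall>\<sigma>. galois_automorphism K \<sigma> \<and> continuous_on UNIV \<sigma> \<longrightarrow> \<sigma> ` L \<subseteq> L)"

definition Fq_linear_polys :: "'q::finite itself \<Rightarrow> 'c::field set \<Rightarrow> 'c poly set" where
  "Fq_linear_polys _ K = {p \<in> poly_over K. \<forall>i. coeff p i \<noteq> 0 \<longrightarrow> (\<exists>k. i = CARD('q) ^ k)}"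

text \<open>The \<open>F\<^sub>q\<close>-linear polynomials form an \<open>F\<^sub>q\<close>-algebra whose multiplication is composition,
  with unit \<open>X\<close>; hence \<open>\<phi> c = c X\<close> for constants \<open>c\<close>.\<close>

definition drinfeld_module ::
  "('q::{field,finite} poly \<Rightarrow> 'c::field) \<Rightarrow> 'c set \<Rightarrow> nat \<Rightarrow> ('q poly \<Rightarrow> 'c poly) \<Rightarrow> bool" where
  "drinfeld_module \<iota> K r \<phi> \<longleftrightarrow> r \<ge> 1 \<and>
     (\<forall>a. \<phi> a \<in> Fq_linear_polys TYPE('q) K) \<and>
     (\<forall>a b. \<phi> (a + b) = \<phi> a + \<phi> b) \<and>
     (\<forall>a b. \<phi> (a * b) = \<phi> a \<circ>\<^sub>p \<phi> b) \<and>
     (\<forall>c. \<phi> [:c:] = [:0, \<iota> [:c:]:]) \<and>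
     (\<exists>g. (\<forall>i\<in>{1..r}. g i \<in> K) \<and> g r \<noteq> 0 \<and>
        \<phi> [:0, 1:] = [:0, \<iota> [:0, 1:]:] + (\<Sum>i=1..r. monom (g i) (CARD('q) ^ i)))"

definition A_independent :: "('q::field poly \<Rightarrow> 'c::field) \<Rightarrow> nat \<Rightarrow> (nat \<Rightarrow> 'c) \<Rightarrow> bool" where
  "A_independent \<iota> i x \<longleftrightarrow>
     (\<forall>a. (\<Sum>j=1..i. \<iota> (a j) * x j) = 0 \<longrightarrow> (\<forall>j\<in>{1..i}. a j = 0))"

definition A_lattice ::
  "('q::field poly \<Rightarrow> 'c::nonarch_field) \<Rightarrow> 'c set \<Rightarrow> nat \<Rightarrow> 'c set \<Rightarrow> bool" where
  "A_lattice \<iota> K r L \<longleftrightarrow> discrete L \<and> galois_stable K L \<and>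
     (\<exists>b. A_independent \<iota> r b \<and> L = range (\<lambda>a. \<Sum>j=1..r. \<iota> (a j) * b j))"

text \<open>\<open>e z = z \<Prod>\<^bsub>\<mu> \<in> L - {0}\<^esub> (1 - z/\<mu>)\<close> as an unordered (in particular convergent) product.\<close>

definition is_lattice_exponential :: "'c::nonarch_field set \<Rightarrow> ('c \<Rightarrow> 'c) \<Rightarrow> bool" where
  "is_lattice_exponential L e \<longleftrightarrow>
     (\<forall>z. ((\<lambda>S. z * (\<Prod>\<mu>\<in>S. (1 - z / \<mu>))) \<longlongrightarrow> e z) (finite_subsets_at_top (L - {0})))"

definition entire :: "('c::nonarch_field \<Rightarrow> 'c) \<Rightarrow> bool" where
  "entire f \<longleftrightarrow> (\<exists>c. \<forall>z. (\<lambda>k. c k * z ^ k) sums f z)"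

definition uniformization ::
  "('q::{field,finite} poly \<Rightarrow> 'c::nonarch_field) \<Rightarrow> 'c set \<Rightarrow> nat \<Rightarrow> ('q poly \<Rightarrow> 'c poly)
     \<Rightarrow> 'c set \<Rightarrow> ('c \<Rightarrow> 'c) \<Rightarrow> bool" where
  "uniformization \<iota> K r \<phi> L e \<longleftrightarrow>
     A_lattice \<iota> K r L \<and> is_lattice_exponential L e \<and>
     entire e \<and> surj e \<and> {z. e z = 0} = L \<and>
     (\<forall>a z. e (\<iota> a * z) = poly (\<phi> a) (e z))"

definition lattice_SMB ::
  "('q::field poly \<Rightarrow> 'c::nonarch_field) \<Rightarrow> 'c set \<Rightarrow> nat \<Rightarrow> (nat \<Rightarrow> 'c) \<Rightarrow> bool" where
  "lattice_SMB \<iota> L r omega \<longleftrightarrow> (\<forall>i\<in>{1..r}.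
     omega i \<in> L \<and> A_independent \<iota> i omega \<and>
     (\<forall>x\<in>L. A_independent \<iota> i (omega(i := x)) \<longrightarrow> absv (omega i) \<le> absv x))"

definition finite_prime :: "'q::field poly \<Rightarrow> bool" where
  "finite_prime u \<longleftrightarrow> lead_coeff u = 1 \<and> irreducible u"

text \<open>\<open>torsion K \<phi> m\<close> is \<open>\<phi>[m]\<close>.\<close>

definition torsion :: "'c::field set \<Rightarrow> ('q::field poly \<Rightarrow> 'c poly) \<Rightarrow> 'q poly \<Rightarrow> 'c set" where
  "torsion K \<phi> m = {x \<in> separable_over K. poly (\<phi> m) x = 0}"

text \<open>Linear independence over \<open>A/m\<close> in \<open>\<phi>[m]\<close>, with scalars given by representatives in \<open>A\<close>:
  a scalar vanishes in \<open>A/m\<close> iff \<open>m\<close> divides it.\<close>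

definition quotient_independent ::
  "('q::field poly \<Rightarrow> 'c::field poly) \<Rightarrow> 'q poly \<Rightarrow> nat \<Rightarrow> (nat \<Rightarrow> 'c) \<Rightarrow> bool" where
  "quotient_independent \<phi> m i x \<longleftrightarrow>
     (\<forall>a. (\<Sum>j=1..i. poly (\<phi> (a j)) (x j)) = 0 \<longrightarrow> (\<forall>j\<in>{1..i}. m dvd a j))"

definition torsion_SMB ::
  "'c::field set \<Rightarrow> ('c \<Rightarrow> ereal) \<Rightarrow> nat \<Rightarrow> ('q::field poly \<Rightarrow> 'c poly) \<Rightarrow> 'q poly
     \<Rightarrow> (nat \<Rightarrow> 'c) \<Rightarrow> bool" where
  "torsion_SMB K w r \<phi> m l \<longleftrightarrow> (\<forall>i\<in>{1..r}.
     l i \<in> torsion K \<phi> m \<and> quotient_independent \<phi> m i l \<and>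
     (\<forall>x\<in>torsion K \<phi> m. quotient_independent \<phi> m i (l(i := x)) \<longrightarrow> w x \<le> w (l i)))"

end

theory Submission
  imports Defs
begin

text \<open>
  A successive minimum basis \<open>\<omega>\<^sub>j\<close> of \<open>\<Lambda>\<close> is an orthogonal \<open>A\<close>-basis:
  \<open>|\<Sum> a\<^sub>j \<omega>\<^sub>j| = max |a\<^sub>j \<omega>\<^sub>j|\<close>. Hence every class of \<open>u\<^bsup>-n\<^esup> \<Lambda> / \<Lambda>\<close> contains some
  \<open>z = \<Sum> (s\<^sub>j / u\<^sup>n) \<omega>\<^sub>j\<close> with \<open>deg s\<^sub>j < deg u\<^sup>n\<close>, and this \<open>z\<close> is of minimal absolute value in
  its class. For such \<open>z\<close> one has \<open>|z - \<mu>| = max |z| |\<mu>|\<close> for all \<open>\<mu> \<in> \<Lambda>\<close>, so that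
  comparing the product for \<open>e\<close> factor by factor gives \<open>|e y| \<le> |e z|\<close> whenever \<open>|y| \<le> |z|\<close>.
  If \<open>e z\<close> is independent of the \<open>e (\<omega>\<^sub>j / u\<^sup>n)\<close> with \<open>j < i\<close>, then \<open>s\<^sub>j \<noteq> 0\<close> for some
  \<open>j \<ge> i\<close>, so \<open>|z| \<ge> |\<omega>\<^sub>i / u\<^sup>n|\<close> by orthogonality, and therefore
  \<open>|e z| \<ge> |e (\<omega>\<^sub>i / u\<^sup>n)|\<close>.
\<close>

section \<open>Ultrametric absolute values\<close>

lemma absv_zero [simp]: "absv (0::'c::nonarch_field) = 0"
  using dist_absv[of "0::'c" 0] by simp

lemma absv_eq_0_iff [simp]: "absv (x::'c::nonarch_field) = 0 \<longleftrightarrow> x = 0"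
  using dist_absv[of x 0] dist_eq_0_iff[of x 0] by simp

lemma absv_nonneg [simp]: "0 \<le> absv (x::'c::nonarch_field)"
  using dist_absv[of x 0] by (metis diff_zero zero_le_dist)

lemma absv_minus [simp]: "absv (- x) = absv (x::'c::nonarch_field)"
  using dist_absv[of x 0] dist_absv[of 0 x] by (simp add: dist_commute)

lemma absv_one [simp]: "absv (1::'c::nonarch_field) = 1"
  using absv_mult[of "1::'c" 1] absv_eq_0_iff[of "1::'c"] by simp

lemma absv_inverse: "absv (inverse x) = inverse (absv (x::'c::nonarch_field))"
proof (cases "x = 0")
  case False
  then have "absv x * absv (inverse x) = 1"
    by (metis absv_mult absv_one right_inverse)
  then show ?thesis
    by (metis inverse_unique)
qed simp

lemma absv_divide: "absv (x / y) = absv x / absv (y::'c::nonarch_field)"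
  by (simp add: divide_inverse absv_mult absv_inverse)

lemma absv_diff_le_max: "absv (x - y) \<le> max (absv x) (absv (y::'c::nonarch_field))"
  using absv_add_le_max[of x "- y"] by simp

lemma absv_prod: "absv (\<Prod>i\<in>I. f i) = (\<Prod>i\<in>I. absv (f i :: 'c::nonarch_field))"
  by (induction I rule: infinite_finite_induct) (auto simp: absv_mult)

lemma absv_sum_le:
  fixes f :: "'i \<Rightarrow> 'c::nonarch_field"
  assumes "\<And>i. i \<in> I \<Longrightarrow> absv (f i) \<le> M" and "0 \<le> M"
  shows "absv (\<Sum>i\<in>I. f i) \<le> M"
  using assms
proof (induction I rule: infinite_finite_induct)
  case (insert i I)
  then show ?case
    using absv_add_le_max[of "f i" "sum f I"] by (auto intro: order_trans)
qed auto

lemma absv_sum_less: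
  fixes f :: "'i \<Rightarrow> 'c::nonarch_field"
  assumes "\<And>i. i \<in> I \<Longrightarrow> absv (f i) < M" and "0 < M"
  shows "absv (\<Sum>i\<in>I. f i) < M"
  using assms
proof (induction I rule: infinite_finite_induct)
  case (insert i I)
  then show ?case
    using absv_add_le_max[of "f i" "sum f I"] by (auto intro: le_less_trans)
qed auto

section \<open>Linear relations over a domain and polynomials of finite additive subgroups\<close>

lemma degree_mod_le: "degree (p mod q) \<le> degree (p :: 'a::field poly)"
proof (cases "degree p < degree q \<or> q = 0")
  case True
  then show ?thesis by (auto simp: mod_poly_less)
next
  case False
  then show ?thesis using degree_mod_less[of q p] by auto
qed

lemma nontrivial_relation:
  fixes v :: "'i \<Rightarrow> nat \<Rightarrow> 'a::idom"
  assumes "finite S" and "card S > d"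
  shows "\<exists>c. (\<exists>i\<in>S. c i \<noteq> 0) \<and> (\<forall>j\<in>{1..d}. (\<Sum>i\<in>S. c i * v i j) = 0)"
  using assms
proof (induction d arbitrary: S v)
  case 0
  then have "S \<noteq> {}" by auto
  then show ?case by (intro exI[of _ "\<lambda>_. 1"]) auto
next
  case (Suc d)
  show ?case
  proof (cases "\<forall>i\<in>S. v i (Suc d) = 0")
    case True
    obtain c where c: "\<exists>i\<in>S. c i \<noteq> 0" "\<forall>j\<in>{1..d}. (\<Sum>i\<in>S. c i * v i j) = 0"
      using Suc.IH[of S v] Suc.prems by auto
    have "(\<Sum>i\<in>S. c i * v i j) = 0" if "j \<in> {1..Suc d}" for j
    proof (cases "j = Suc d")
      case True
      then show ?thesis using \<open>\<forall>i\<in>S. v i (Suc d) = 0\<close> by (simp add: sum.neutral)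
    next
      case False
      then show ?thesis using c(2) that by auto
    qed
    then show ?thesis using c(1) by blast
  next
    case False
    then obtain p where p: "p \<in> S" "v p (Suc d) \<noteq> 0" by blast
    define S' where "S' = S - {p}"
    define v' where "v' i j = v p (Suc d) * v i j - v i (Suc d) * v p j" for i j
    have "finite S'" "card S' > d"
      using Suc.prems p by (auto simp: S'_def)
    then obtain c where c: "\<exists>i\<in>S'. c i \<noteq> 0" "\<forall>j\<in>{1..d}. (\<Sum>i\<in>S'. c i * v' i j) = 0"
      using Suc.IH[of S' v'] by blast
    \<comment> \<open>Expanding \<open>c i * v' i j\<close> and collecting the multiples of
      \<open>v p j\<close> dictates these coefficients. A nonzero \<open>c i\<close> stays nonzero
      because the pivot entry is nonzero.\<close>
    define c' where "c' i = (if i = p then - (\<Sum>i\<in>S'. c i * v i (Suc d)) else v p (Suc d) * c i)" for i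
    have *: "(\<Sum>i\<in>S. c' i * v i j) = (\<Sum>i\<in>S'. c i * v' i j)" for j
    proof -
      have "(\<Sum>i\<in>S. c' i * v i j) = c' p * v p j + (\<Sum>i\<in>S'. c' i * v i j)"
        unfolding S'_def using p Suc.prems by (simp add: sum.remove)
      also have "(\<Sum>i\<in>S'. c' i * v i j) = (\<Sum>i\<in>S'. v p (Suc d) * c i * v i j)"
        by (intro sum.cong) (auto simp: c'_def S'_def)
      also have "c' p * v p j + \<dots> = (\<Sum>i\<in>S'. c i * v' i j)"
        by (simp add: c'_def v'_def algebra_simps sum_subtractf sum_distrib_left)
      finally show ?thesis .
    qed
    have "(\<Sum>i\<in>S. c' i * v i j) = 0" if "j \<in> {1..Suc d}" for j
    proof (cases "j = Suc d")
      case True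
      then show ?thesis unfolding * by (simp add: v'_def mult.commute)
    next
      case False
      then show ?thesis unfolding * using c(2) that by auto
    qed
    moreover have "\<exists>i\<in>S. c' i \<noteq> 0"
      using c(1) p by (auto simp: c'_def S'_def)
    ultimately show ?thesis by blast
  qed
qed

text \<open>For fixed \<open>y\<close>, both sides are polynomials in \<open>x\<close>. Translation
  by an element of the subgroup permutes the factors, so the two sides agree on all of
  \<open>V\<close>.\<close>

lemma subgroup_polynomial_additive:
  fixes V :: "'c::field set"
  assumes "finite V" "0 \<in> V" "\<And>x y. x \<in> V \<Longrightarrow> y \<in> V \<Longrightarrow> x - y \<in> V"
  shows "(\<Prod>v\<in>V. x + y - v) = (\<Prod>v\<in>V. x - v) + (\<Prod>v\<in>V. y - v)"
proof -
  define f where "f = (\<Prod>v\<in>V. [:- v, 1:])"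
  have f: "poly f z = (\<Prod>v\<in>V. z - v)" for z
    by (simp add: f_def poly_prod)
  have deg_f: "degree f = card V"
    unfolding f_def by (subst degree_prod_eq_sum_degree) auto
  have lead_f: "lead_coeff f = 1"
    unfolding f_def by (simp add: lead_coeff_prod)
  have "card V > 0" using assms by (auto simp: card_gt_0_iff)
  have add: "a + b \<in> V" if "a \<in> V" "b \<in> V" for a b
    using assms(3)[of a "0 - b"] assms(3)[of 0 b] assms(2) that by simp
  \<comment> \<open>Two monic polynomials of degree \<open>card V\<close> that agree on \<open>V\<close>.\<close>
  have "f \<circ>\<^sub>p [:y, 1:] = f + [:poly f y:]"
  proof (rule poly_eqI_degree_lead_coeff)
    show "\<And>v. v \<in> V \<Longrightarrow> poly (f \<circ>\<^sub>p [:y, 1:]) v = poly (f + [:poly f y:]) v"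
    proof -
      fix v assume v: "v \<in> V"
      have "(\<Prod>u\<in>V. y + v - u) = (\<Prod>u\<in>V. y - u)"
        by (rule prod.reindex_bij_witness[of _ "\<lambda>u. u + v" "\<lambda>u. u - v"])
           (use v assms(3) add in auto)
      moreover have "poly f v = 0"
        unfolding f using v assms(1) by auto
      ultimately show "poly (f \<circ>\<^sub>p [:y, 1:]) v = poly (f + [:poly f y:]) v"
        by (simp add: poly_pcompose f)
    qed
    show "coeff (f \<circ>\<^sub>p [:y, 1:]) (card V) = coeff (f + [:poly f y:]) (card V)"
    proof -
      have "coeff (f \<circ>\<^sub>p [:y, 1:]) (card V) = lead_coeff (f \<circ>\<^sub>p [:y, 1:])"
        by (simp add: degree_pcompose deg_f)
      also have "\<dots> = 1" by (subst lead_coeff_comp) (use lead_f in auto)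
      finally show ?thesis
        using lead_f deg_f \<open>card V > 0\<close> by (simp add: coeff_pCons split: nat.splits)
    qed
    show "degree (f + [:poly f y:]) \<le> card V"
      by (intro degree_add_le) (auto simp: deg_f)
  qed (auto simp: degree_pcompose deg_f)
  then have "poly (f \<circ>\<^sub>p [:y, 1:]) x = poly (f + [:poly f y:]) x" by simp
  then show ?thesis by (simp add: poly_pcompose f add.commute)
qed

text \<open>Pulling \<open>- inverse v\<close> out of each factor leaves a constant multiple of the
  monic subgroup polynomial. Such products are partial products of the lattice exponential.\<close>

lemma subgroup_product_additive:
  fixes V :: "'c::field set"
  assumes "finite V" "0 \<in> V" "\<And>x y. x \<in> V \<Longrightarrow> y \<in> V \<Longrightarrow> x - y \<in> V"
  shows "(x + y) * (\<Prod>v\<in>V-{0}. 1 - (x + y) / v) =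
    x * (\<Prod>v\<in>V-{0}. 1 - x / v) + y * (\<Prod>v\<in>V-{0}. 1 - y / v)"
proof -
  have "z * (\<Prod>v\<in>V-{0}. 1 - z / v) = (\<Prod>v\<in>V-{0}. - inverse v) * (\<Prod>v\<in>V. z - v)" for z
  proof -
    have "(\<Prod>v\<in>V-{0}. 1 - z / v) = (\<Prod>v\<in>V-{0}. - inverse v * (z - v))"
      by (intro prod.cong) (auto simp: field_simps)
    then show ?thesis
      using assms(1,2) by (simp only: prod.distrib prod.remove[of V 0] diff_zero mult_ac)
  qed
  then show ?thesis
    by (simp add: subgroup_polynomial_additive[OF assms] distrib_left)
qed

section \<open>The inclusion of \<open>A\<close>, and \<open>A\<close>-linear combinations\<close>

locale A_embedding =
  fixes \<iota> :: "'q::{field,finite} poly \<Rightarrow> 'c::nonarch_field"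
  assumes A_inclusion: "A_inclusion \<iota>"
begin

lemma iota_one [simp]: "\<iota> 1 = 1"
  and iota_add: "\<iota> (a + b) = \<iota> a + \<iota> b"
  and iota_mult: "\<iota> (a * b) = \<iota> a * \<iota> b"
  and absv_iota: "a \<noteq> 0 \<Longrightarrow> absv (\<iota> a) = real CARD('q) ^ degree a"
  using A_inclusion by (auto simp: A_inclusion_def)

lemma iota_zero [simp]: "\<iota> 0 = 0"
  using iota_add[of 0 0] by (metis add_0_right add_cancel_right_right)

lemma iota_minus: "\<iota> (- a) = - \<iota> a"
  using iota_add[of a "- a"] by (simp add: eq_neg_iff_add_eq_0 add.commute)

lemma iota_diff: "\<iota> (a - b) = \<iota> a - \<iota> b"
  using iota_add[of a "- b"] by (simp add: iota_minus)

lemma iota_sum: "\<iota> (\<Sum>i\<in>I. f i) = (\<Sum>i\<in>I. \<iota> (f i))"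
  by (induction I rule: infinite_finite_induct) (auto simp: iota_add)

lemma card_q_gt_1: "1 < CARD('q)"
proof -
  have "card {0, 1::'q} \<le> CARD('q)" by (intro card_mono) auto
  then show ?thesis by simp
qed

lemma iota_eq_0_iff [simp]: "\<iota> a = 0 \<longleftrightarrow> a = 0"
  using absv_iota[of a] card_q_gt_1 by fastforce

lemma absv_iota_mono: "b \<noteq> 0 \<Longrightarrow> degree a \<le> degree b \<Longrightarrow> absv (\<iota> a) \<le> absv (\<iota> b)"
  using card_q_gt_1 by (cases "a = 0") (auto simp: absv_iota intro!: power_increasing)

lemma absv_iota_ge_1: "a \<noteq> 0 \<Longrightarrow> 1 \<le> absv (\<iota> a)"
  using absv_iota_mono[of a 1] by simp

lemma absv_iota_mod_less: "b \<noteq> 0 \<Longrightarrow> absv (\<iota> (a mod b)) < absv (\<iota> b)"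
proof (cases "a mod b = 0")
  case False
  assume "b \<noteq> 0"
  then show ?thesis
    using False card_q_gt_1 degree_mod_less[of b a] by (auto simp: absv_iota)
qed (simp add: less_le)

definition combinations :: "nat \<Rightarrow> (nat \<Rightarrow> 'c) \<Rightarrow> 'c set" where
  "combinations r b = range (\<lambda>a. \<Sum>j=1..r. \<iota> (a j) * b j)"

lemma combinationsI: "(\<Sum>j=1..r. \<iota> (a j) * b j) \<in> combinations r b"
  unfolding combinations_def by (rule rangeI)

lemma combinations_diff:
  assumes "x \<in> combinations r b" "y \<in> combinations r b"
  shows "x - y \<in> combinations r b"
proof -
  obtain f g where "x = (\<Sum>j=1..r. \<iota> (f j) * b j)" "y = (\<Sum>j=1..r. \<iota> (g j) * b j)"
    using assms by (auto simp: combinations_def)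
  then have "x - y = (\<Sum>j=1..r. \<iota> (f j - g j) * b j)"
    by (simp add: iota_diff left_diff_distrib sum_subtractf)
  then show ?thesis by (simp only: combinationsI)
qed

lemma combinations_zero: "0 \<in> combinations r b"
  unfolding combinations_def by (rule range_eqI[of _ _ "\<lambda>_. 0"]) simp

lemma combinations_add:
  "x \<in> combinations r b \<Longrightarrow> y \<in> combinations r b \<Longrightarrow> x + y \<in> combinations r b"
  using combinations_diff[of x r b "0 - y"] combinations_diff[of 0 r b y] combinations_zero by simp

lemma combinations_scale:
  assumes "x \<in> combinations r b"
  shows "\<iota> c * x \<in> combinations r b"
proof -
  obtain f where "x = (\<Sum>j=1..r. \<iota> (f j) * b j)"
    using assms by (auto simp: combinations_def)
  then have "\<iota> c * x = (\<Sum>j=1..r. \<iota> (c * f j) * b j)"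
    by (simp add: iota_mult sum_distrib_left mult.assoc)
  then show ?thesis by (simp only: combinationsI)
qed

lemma combinations_sum:
  "(\<And>i. i \<in> I \<Longrightarrow> f i \<in> combinations r b) \<Longrightarrow> (\<Sum>i\<in>I. f i) \<in> combinations r b"
  by (induction I rule: infinite_finite_induct) (auto simp: combinations_zero combinations_add)

text \<open>As the constant field is finite, coefficients of bounded degree yield a finite subgroup,
  and a large enough bound captures any given finite set. These subgroups supply the additive
  partial products of the exponential.\<close>

lemma combinations_exhausted_by_finite_subgroups:
  assumes "finite S" "S \<subseteq> combinations r b"
  obtains V where "finite V" "S \<subseteq> V" "V \<subseteq> combinations r b" "0 \<in> V"
    "\<And>x y. x \<in> V \<Longrightarrow> y \<in> V \<Longrightarrow> x - y \<in> V"
proof -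
  define P where "P N = {p :: 'q poly. degree p < Suc N}" for N
  define V where "V N = (\<lambda>a. \<Sum>j=1..r. \<iota> (a j) * b j) ` (PiE {1..r} (\<lambda>_. P N))" for N
  have fin: "finite (P N)" for N
  proof (rule finite_surj)
    show "finite {xs :: 'q list. set xs \<subseteq> UNIV \<and> length xs \<le> Suc N}"
      by (intro finite_lists_length_le) auto
    show "P N \<subseteq> Poly ` {xs :: 'q list. set xs \<subseteq> UNIV \<and> length xs \<le> Suc N}"
    proof
      fix p assume "p \<in> P N"
      then have "length (coeffs p) \<le> Suc N" by (cases "p = 0") (auto simp: P_def length_coeffs_degree)
      then show "p \<in> Poly ` {xs :: 'q list. set xs \<subseteq> UNIV \<and> length xs \<le> Suc N}"
        by (intro image_eqI[of _ _ "coeffs p"]) auto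
    qed
  qed
  have V_I: "(\<Sum>j=1..r. \<iota> (a j) * b j) \<in> V N" if "\<And>j. j \<in> {1..r} \<Longrightarrow> a j \<in> P N" for a N
    unfolding V_def by (rule image_eqI[of _ _ "restrict a {1..r}"]) (use that in auto)
  have "\<exists>N. S \<subseteq> V N"
    using assms
  proof (induction S rule: finite_induct)
    case (insert x S)
    then obtain N where N: "S \<subseteq> V N" by auto
    obtain a where a: "x = (\<Sum>j=1..r. \<iota> (a j) * b j)"
      using insert.prems by (auto simp: combinations_def)
    define M where "M = Max (insert N ((\<lambda>j. degree (a j)) ` {1..r}))"
    have "degree (a j) \<le> M" if "j \<in> {1..r}" for j
      unfolding M_def using that by (intro Max_ge) auto
    then have "x \<in> V M"
      unfolding a by (intro V_I) (auto simp: P_def le_imp_less_Suc)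
    moreover have "N \<le> M" unfolding M_def by (intro Max_ge) auto
    then have "V N \<subseteq> V M"
      unfolding V_def by (intro image_mono PiE_mono) (auto simp: P_def)
    ultimately show ?case using N by blast
  qed auto
  then obtain N where N: "S \<subseteq> V N" by blast
  show thesis
  proof (rule that[of "V N"])
    show "finite (V N)" unfolding V_def by (intro finite_imageI finite_PiE fin) auto
    show "V N \<subseteq> combinations r b" unfolding V_def combinations_def by blast
    show "0 \<in> V N" using V_I[of "\<lambda>_. 0" N] by (simp add: P_def)
    show "x - y \<in> V N" if xy: "x \<in> V N" "y \<in> V N" for x y
    proof -
      obtain f g where fg: "x = (\<Sum>j=1..r. \<iota> (f j) * b j)" "y = (\<Sum>j=1..r. \<iota> (g j) * b j)"
        "\<And>j. j \<in> {1..r} \<Longrightarrow> f j \<in> P N" "\<And>j. j \<in> {1..r} \<Longrightarrow> g j \<in> P N"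
        using xy unfolding V_def by (auto simp: PiE_iff)
      have "x - y = (\<Sum>j=1..r. \<iota> (f j - g j) * b j)"
        using fg by (simp add: iota_diff left_diff_distrib sum_subtractf)
      also have "\<dots> \<in> V N"
        using fg by (intro V_I) (auto simp: P_def intro: degree_diff_less)
      finally show ?thesis .
    qed
  qed (use N in auto)
qed

section \<open>Additivity and monotonicity of the lattice exponential\<close>

lemma lattice_exponential_additive:
  assumes e: "is_lattice_exponential (combinations r b) e"
  shows "e (x + y) = e x + e y"
proof (rule ccontr)
  define L where "L = combinations r b"
  define P where "P S z = z * (\<Prod>\<mu>\<in>S. (1 - z / \<mu>))" for S and z :: 'c
  assume "e (x + y) \<noteq> e x + e y"
  \<comment> \<open>The tolerance is the failure of additivity itself: by the ultrametric
    inequality, three approximation errors below it cannot add up to it.\<close>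
  define \<epsilon> where "\<epsilon> = absv (e (x + y) - (e x + e y))"
  have "\<epsilon> > 0"
    using \<open>e (x + y) \<noteq> e x + e y\<close> absv_nonneg unfolding \<epsilon>_def by (simp add: less_le)
  have "eventually (\<lambda>S. absv (P S z - e z) < \<epsilon>) (finite_subsets_at_top (L - {0}))" for z
  proof -
    have "((\<lambda>S. P S z) \<longlongrightarrow> e z) (finite_subsets_at_top (L - {0}))"
      using e by (simp add: is_lattice_exponential_def L_def P_def)
    from tendstoD[OF this \<open>\<epsilon> > 0\<close>] show ?thesis by (simp add: dist_absv)
  qed
  then have "eventually (\<lambda>S. absv (P S x - e x) < \<epsilon> \<and> absv (P S y - e y) < \<epsilon> \<and>
      absv (P S (x + y) - e (x + y)) < \<epsilon>) (finite_subsets_at_top (L - {0}))"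
    by (intro eventually_conj)
  then have "\<exists>S0. finite S0 \<and> S0 \<subseteq> L - {0} \<and> (\<forall>S. finite S \<and> S0 \<subseteq> S \<and> S \<subseteq> L - {0} \<longrightarrow>
      absv (P S x - e x) < \<epsilon> \<and> absv (P S y - e y) < \<epsilon> \<and> absv (P S (x + y) - e (x + y)) < \<epsilon>)"
    by (simp only: eventually_finite_subsets_at_top)
  then obtain S0 where S0: "finite S0" "S0 \<subseteq> L - {0}"
    and close: "\<forall>S. finite S \<and> S0 \<subseteq> S \<and> S \<subseteq> L - {0} \<longrightarrow>
      absv (P S x - e x) < \<epsilon> \<and> absv (P S y - e y) < \<epsilon> \<and> absv (P S (x + y) - e (x + y)) < \<epsilon>"
    by (elim exE conjE)
  \<comment> \<open>Convergence is along all finite subsets, so the partial product may be taken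
    over the nonzero part of a finite subgroup, where it is exactly additive.\<close>
  obtain V where V: "finite V" "S0 \<subseteq> V" "V \<subseteq> L" "0 \<in> V"
    "\<And>x y. x \<in> V \<Longrightarrow> y \<in> V \<Longrightarrow> x - y \<in> V"
    by (rule combinations_exhausted_by_finite_subgroups[of S0 r b])
       (use S0 in \<open>auto simp: L_def\<close>)
  have c: "absv (P (V-{0}) x - e x) < \<epsilon>" "absv (P (V-{0}) y - e y) < \<epsilon>"
    "absv (P (V-{0}) (x + y) - e (x + y)) < \<epsilon>"
    using spec[OF close, of "V - {0}"] V(1-3) S0 by auto
  have "P (V-{0}) (x + y) = P (V-{0}) x + P (V-{0}) y"
    unfolding P_def by (rule subgroup_product_additive) (use V in auto)
  then have "e (x + y) - (e x + e y) =
    ((P (V-{0}) x - e x) + (P (V-{0}) y - e y)) - (P (V-{0}) (x + y) - e (x + y))"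
    by simp
  then have "\<epsilon> \<le> max (absv ((P (V-{0}) x - e x) + (P (V-{0}) y - e y)))
      (absv (P (V-{0}) (x + y) - e (x + y)))"
    unfolding \<epsilon>_def by (metis absv_diff_le_max)
  also have "\<dots> < \<epsilon>"
    using c absv_add_le_max[of "P (V-{0}) x - e x" "P (V-{0}) y - e y"] by simp
  finally show False by simp
qed

text \<open>The partial products are compared factor by factor. Since \<open>z'\<close> is no larger
  than \<open>z' - \<mu>\<close>, the ultrametric inequality bounds \<open>\<mu>\<close> by
  \<open>z' - \<mu>\<close> too; hence it bounds \<open>z - \<mu>\<close>.\<close>

lemma lattice_exponential_mono:
  assumes e: "is_lattice_exponential L e"
    and closest: "\<And>\<mu>. \<mu> \<in> L \<Longrightarrow> absv z' \<le> absv (z' - \<mu>)"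
    and le: "absv z \<le> absv z'"
  shows "absv (e z) \<le> absv (e z')"
proof (rule tendsto_le)
  let ?P = "\<lambda>z S. z * (\<Prod>\<mu>\<in>S. (1 - z / \<mu>))"
  have "((\<lambda>S. dist (?P z S) 0) \<longlongrightarrow> dist (e z) 0) (finite_subsets_at_top (L - {0}))" for z
    using e unfolding is_lattice_exponential_def by (intro tendsto_dist tendsto_const) auto
  then show "((\<lambda>S. absv (?P z S)) \<longlongrightarrow> absv (e z)) (finite_subsets_at_top (L - {0}))"
    and "((\<lambda>S. absv (?P z' S)) \<longlongrightarrow> absv (e z')) (finite_subsets_at_top (L - {0}))"
    by (simp_all add: dist_absv)
  have factor: "absv (1 - z / \<mu>) \<le> absv (1 - z' / \<mu>)" if \<mu>: "\<mu> \<in> L - {0}" for \<mu>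
  proof -
    have "absv \<mu> \<le> max (absv z') (absv (z' - \<mu>))"
      using absv_diff_le_max[of z' "z' - \<mu>"] by simp
    then have "absv (z - \<mu>) \<le> absv (z' - \<mu>)"
      using closest[of \<mu>] \<mu> le absv_diff_le_max[of z \<mu>] by auto
    moreover have "absv (1 - y / \<mu>) = absv (y - \<mu>) / absv \<mu>" for y
    proof -
      have "1 - y / \<mu> = - ((y - \<mu>) / \<mu>)" using \<mu> by (simp add: field_simps)
      then show ?thesis by (simp add: absv_divide)
    qed
    ultimately show ?thesis by (simp add: divide_right_mono)
  qed
  show "eventually (\<lambda>S. absv (?P z S) \<le> absv (?P z' S)) (finite_subsets_at_top (L - {0}))"
  proof (rule eventually_finite_subsets_at_top_weakI)
    fix S assume "finite S" "S \<subseteq> L - {0}"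
    then show "absv (?P z S) \<le> absv (?P z' S)"
      unfolding absv_mult absv_prod
      by (intro mult_mono prod_mono le prod_nonneg) (auto intro: factor)
  qed
qed simp

section \<open>Successive minimum bases of the lattice\<close>

lemma A_independent_exchange:
  assumes ind: "A_independent \<iota> k v"
    and x: "\<iota> d * x = (\<Sum>j=1..k. \<iota> (a j) * v j)"
    and "d \<noteq> 0" "a k \<noteq> 0" "k \<ge> 1"
  shows "A_independent \<iota> k (v(k := x))"
  unfolding A_independent_def
proof (intro allI impI)
  fix c assume c: "(\<Sum>j=1..k. \<iota> (c j) * (v(k := x)) j) = 0"
  have split: "(\<Sum>j=1..k. f j) = (\<Sum>j=1..<k. f j) + f k" for f :: "nat \<Rightarrow> 'c"
    using \<open>k \<ge> 1\<close> by (simp add: sum.last_plus add.commute)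
  \<comment> \<open>Multiplying the relation by \<open>d\<close> and substituting for
    \<open>d * x\<close> produces these coefficients. Independence first kills \<open>c k\<close>,
    as \<open>a k\<close> is nonzero, and then the others, as \<open>d\<close> is nonzero.\<close>
  define c' where "c' j = (if j = k then c k * a k else d * c j + c k * a j)" for j
  have "(\<Sum>j=1..k. \<iota> (c' j) * v j) =
      (\<Sum>j=1..<k. \<iota> d * (\<iota> (c j) * v j) + \<iota> (c k) * (\<iota> (a j) * v j)) + \<iota> (c k) * (\<iota> (a k) * v k)"
    unfolding split
    by (intro arg_cong2[of _ _ _ _ "(+)"] sum.cong)
       (auto simp: c'_def iota_mult iota_add algebra_simps)
  also have "\<dots> = \<iota> d * (\<Sum>j=1..<k. \<iota> (c j) * v j) + \<iota> (c k) * (\<Sum>j=1..k. \<iota> (a j) * v j)"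
    unfolding split by (simp add: sum.distrib sum_distrib_left algebra_simps)
  also have "\<dots> = \<iota> d * ((\<Sum>j=1..<k. \<iota> (c j) * v j) + \<iota> (c k) * x)"
    unfolding x[symmetric] by (simp add: algebra_simps)
  also have "\<dots> = \<iota> d * (\<Sum>j=1..k. \<iota> (c j) * (v(k := x)) j)"
    unfolding split by (intro arg_cong[of _ _ "(*) _"] arg_cong2[of _ _ _ _ "(+)"] sum.cong) auto
  also have "\<dots> = 0" using c by simp
  finally have c': "\<forall>j\<in>{1..k}. c' j = 0"
    using ind unfolding A_independent_def by blast
  then have "c k = 0"
    using \<open>k \<ge> 1\<close> \<open>a k \<noteq> 0\<close> by (auto simp: c'_def dest: bspec[of _ _ k])
  then show "\<forall>j\<in>{1..k}. c j = 0"
    using c' \<open>d \<noteq> 0\<close> by (auto simp: c'_def split: if_splits)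
qed

text \<open>A subfamily of an independent family is independent. In this form \<open>v k\<close>
  becomes a competitor for the \<open>j\<close>-th minimum, which makes the sizes in an SMB
  nondecreasing.\<close>

lemma A_independent_skip:
  assumes ind: "A_independent \<iota> k v" and "1 \<le> j" "j \<le> k"
  shows "A_independent \<iota> j (v(j := v k))"
  unfolding A_independent_def
proof (intro allI impI)
  fix c assume c: "(\<Sum>i=1..j. \<iota> (c i) * (v(j := v k)) i) = 0"
  define c' where "c' i = (if i < j then c i else if i = k then c j else 0)" for i
  have "(\<Sum>i=1..k. \<iota> (c' i) * v i) = (\<Sum>i\<in>insert k {1..<j}. \<iota> (c' i) * v i)"
    using assms by (intro sum.mono_neutral_right) (auto simp: c'_def)
  also have "\<dots> = \<iota> (c j) * v k + (\<Sum>i=1..<j. \<iota> (c i) * v i)"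
    using assms by (auto simp: c'_def intro!: sum.cong)
  also have "\<dots> = (\<Sum>i=1..j. \<iota> (c i) * (v(j := v k)) i)"
    using \<open>1 \<le> j\<close> by (auto simp: sum.last_plus intro!: sum.cong)
  finally have "\<forall>i\<in>{1..k}. c' i = 0"
    using c ind unfolding A_independent_def by simp
  then have c'0: "c' i = 0" if "i \<in> {1..k}" for i using that by blast
  have "c i = 0" if "i \<in> {1..j}" for i
    using c'0[of k] c'0[of i] that assms(2,3) by (cases "i = j") (auto simp: c'_def)
  then show "\<forall>i\<in>{1..j}. c i = 0" by blast
qed

lemma lattice_SMB_mono:
  assumes "lattice_SMB \<iota> L r omega" "1 \<le> j" "j \<le> k" "k \<le> r"
  shows "absv (omega j) \<le> absv (omega k)"
proof -
  have "A_independent \<iota> k omega" "omega k \<in> L"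
    using assms by (simp_all add: lattice_SMB_def)
  moreover have "\<forall>x\<in>L. A_independent \<iota> j (omega(j := x)) \<longrightarrow> absv (omega j) \<le> absv x"
    using assms by (simp add: lattice_SMB_def)
  ultimately show ?thesis
    using A_independent_skip[OF _ assms(2,3)] by blast
qed

text \<open>If cancellation occurred in the sum, dividing by the coefficient of the last term of maximal
  size would produce a lattice vector shorter than the corresponding \<open>omega k\<close>.\<close>

lemma lattice_SMB_orthogonal:
  assumes smb: "lattice_SMB \<iota> (combinations r b) r omega" and i: "i \<in> {1..r}"
  shows "absv (\<iota> (a i) * omega i) \<le> absv (\<Sum>j=1..r. \<iota> (a j) * omega j)"
proof (rule ccontr)
  let ?s = "\<Sum>j=1..r. \<iota> (a j) * omega j"
  define t where "t j = absv (\<iota> (a j) * omega j)" for j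
  define M where "M = Max (t ` {1..r})"
  assume "\<not> absv (\<iota> (a i) * omega i) \<le> absv ?s"
  then have "absv ?s < t i" by (simp add: t_def)
  also have "t i \<le> M" using i unfolding M_def by (intro Max_ge) auto
  finally have s: "absv ?s < M" .
  then have M: "0 < M" using absv_nonneg[of ?s] by linarith
  have tM: "t j \<le> M" if "j \<in> {1..r}" for j using that unfolding M_def by (intro Max_ge) auto
  \<comment> \<open>Taking the last index of maximal size makes all later terms strictly smaller
    than \<open>M\<close>; earlier ones are controlled by the monotonicity of the sizes of
    \<open>omega\<close>.\<close>
  define k where "k = Max {j \<in> {1..r}. t j = M}"
  have "M \<in> t ` {1..r}" unfolding M_def using i by (intro Max_in) auto
  then have ne: "{j \<in> {1..r}. t j = M} \<noteq> {}" by auto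
  have k: "k \<in> {1..r}" "t k = M"
    using Max_in[OF _ ne] unfolding k_def by auto
  have after_k: "t j < M" if "j \<in> {k<..r}" for j
  proof -
    have "j \<in> {1..r}" using that k by auto
    moreover have "t j \<noteq> M"
    proof
      assume "t j = M"
      then have "j \<le> k" unfolding k_def using \<open>j \<in> {1..r}\<close> by (intro Max_ge) auto
      with that show False by simp
    qed
    ultimately show ?thesis using tM[of j] by simp
  qed
  have ak: "a k \<noteq> 0" using k(2) M by (auto simp: t_def)
  \<comment> \<open>This is \<open>?s\<close> divided by \<open>a k\<close> and rounded into the
    lattice: quotients before \<open>k\<close>, nothing after \<open>k\<close>. After multiplication
    by \<open>a k\<close>, the errors before \<open>k\<close> are remainders times vectors no longer
    than \<open>omega k\<close>, so they stay below \<open>M\<close>.\<close>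
  define x where "x = omega k + (\<Sum>j=1..<k. \<iota> (a j div a k) * omega j)"
  have split: "?s = (\<Sum>j=1..<k. \<iota> (a j) * omega j) + \<iota> (a k) * omega k
      + (\<Sum>j\<in>{k<..r}. \<iota> (a j) * omega j)"
  proof -
    have "{1..r} = insert k ({1..<k} \<union> {k<..r})" using k by auto
    moreover have "{1..<k} \<inter> {k<..r} = {}" by auto
    ultimately show ?thesis by (simp add: sum.union_disjoint add_ac)
  qed
  have "\<iota> (a k) * x = ?s - ((\<Sum>j=1..<k. \<iota> (a j mod a k) * omega j)
      + (\<Sum>j\<in>{k<..r}. \<iota> (a j) * omega j))"
  proof -
    have "(\<Sum>j=1..<k. \<iota> (a j) * omega j) = (\<Sum>j=1..<k. \<iota> (a k * (a j div a k) + a j mod a k) * omega j)"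
      by simp
    also have "\<dots> = \<iota> (a k) * (\<Sum>j=1..<k. \<iota> (a j div a k) * omega j)
        + (\<Sum>j=1..<k. \<iota> (a j mod a k) * omega j)"
      unfolding iota_add iota_mult by (simp add: algebra_simps sum.distrib sum_distrib_left)
    finally show ?thesis
      unfolding split x_def by (simp add: algebra_simps)
  qed
  moreover have "absv (\<Sum>j=1..<k. \<iota> (a j mod a k) * omega j) < M"
  proof (rule absv_sum_less)
    fix j assume j: "j \<in> {1..<k}"
    have "absv (\<iota> (a j mod a k) * omega j) \<le> absv (\<iota> (a j mod a k)) * absv (omega k)"
      unfolding absv_mult using lattice_SMB_mono[OF smb, of j k] j k by (intro mult_left_mono) auto
    also have "\<dots> < absv (\<iota> (a k)) * absv (omega k)"
      using absv_iota_mod_less[OF ak] k(2) M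
      by (intro mult_strict_right_mono) (auto simp: t_def less_le)
    finally show "absv (\<iota> (a j mod a k) * omega j) < M"
      using k(2) by (simp add: t_def absv_mult)
  qed (rule M)
  moreover have "absv (\<Sum>j\<in>{k<..r}. \<iota> (a j) * omega j) < M"
    using after_k M by (intro absv_sum_less) (auto simp: t_def)
  ultimately have "absv (\<iota> (a k) * x) < M"
    using s absv_diff_le_max absv_add_le_max by (smt (verit))
  then have "absv (\<iota> (a k)) * absv x < absv (\<iota> (a k)) * absv (omega k)"
    using k(2) by (simp add: t_def absv_mult)
  then have "absv x < absv (omega k)"
    by (metis absv_nonneg mult_less_cancel_left_disj not_less)
  moreover have "x \<in> combinations r b"
    using smb k unfolding x_def lattice_SMB_def
    by (intro combinations_add combinations_sum combinations_scale) auto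
  \<comment> \<open>The exchange has denominator 1 and coefficient 1 at \<open>omega k\<close>, so
    \<open>x\<close> is admissible for the \<open>k\<close>-th minimum.\<close>
  moreover have "A_independent \<iota> k (omega(k := x))"
  proof (rule A_independent_exchange)
    show "A_independent \<iota> k omega" using smb k by (auto simp: lattice_SMB_def)
    show "\<iota> 1 * x = (\<Sum>j=1..k. \<iota> (if j = k then 1 else a j div a k) * omega j)"
      using k by (auto simp: x_def sum.last_plus intro!: sum.cong)
  qed (use k in auto)
  ultimately show False
    using smb k unfolding lattice_SMB_def by fastforce
qed

text \<open>A dependence among \<open>x\<close> and the \<open>omega j\<close> expresses
  \<open>x\<close> with a common denominator. Division with remainder by this denominator leaves a
  lattice vector which, if nonzero, would be shorter than some \<open>omega k\<close>.\<close>

lemma lattice_SMB_generates: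
  assumes smb: "lattice_SMB \<iota> (combinations r b) r omega" and r: "1 \<le> r"
    and x: "x \<in> combinations r b"
  obtains m where "x = (\<Sum>j=1..r. \<iota> (m j) * omega j)"
proof -
  have ind: "A_independent \<iota> k omega" if "k \<in> {1..r}" for k
    using smb that by (auto simp: lattice_SMB_def)
  \<comment> \<open>Index 0 carries \<open>x\<close>, so there are \<open>r + 1\<close> vectors with
    coordinates in rank \<open>r\<close>.\<close>
  define y where "y i = (if i = 0 then x else omega i)" for i
  have "\<exists>f. y i = (\<Sum>j=1..r. \<iota> (f j) * b j)" if "i \<in> {0..r}" for i
    using that smb x by (cases "i = 0") (auto simp: y_def lattice_SMB_def combinations_def image_iff)
  then obtain f where f: "\<And>i. i \<in> {0..r} \<Longrightarrow> y i = (\<Sum>j=1..r. \<iota> (f i j) * b j)"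
    by metis
  obtain c where c: "\<exists>i\<in>{0..r}. c i \<noteq> 0" "\<forall>j\<in>{1..r}. (\<Sum>i\<in>{0..r}. c i * f i j) = 0"
    using nontrivial_relation[of "{0..r}" r f] by auto
  have "(\<Sum>i=0..r. \<iota> (c i) * y i) = (\<Sum>i=0..r. \<Sum>j=1..r. \<iota> (c i * f i j) * b j)"
    by (intro sum.cong refl) (simp add: f sum_distrib_left iota_mult mult.assoc)
  also have "\<dots> = (\<Sum>j=1..r. \<Sum>i=0..r. \<iota> (c i * f i j) * b j)"
    by (rule sum.swap)
  also have "\<dots> = (\<Sum>j=1..r. \<iota> (\<Sum>i=0..r. c i * f i j) * b j)"
    by (simp add: iota_sum sum_distrib_right)
  also have "\<dots> = 0" using c(2) by simp
  finally have rel: "\<iota> (c 0) * x + (\<Sum>i=1..r. \<iota> (c i) * omega i) = 0"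
    by (simp add: sum.atLeast_Suc_atMost y_def)
  have c0: "c 0 \<noteq> 0"
  proof
    assume "c 0 = 0"
    then have "\<forall>i\<in>{1..r}. c i = 0"
      using rel ind[of r] r unfolding A_independent_def by auto
    with \<open>c 0 = 0\<close> c(1) show False by (metis atLeastAtMost_iff less_one not_le)
  qed
  define m where "m j = (- c j) div c 0" for j
  define s where "s j = (- c j) mod c 0" for j
  define x' where "x' = x - (\<Sum>j=1..r. \<iota> (m j) * omega j)"
  have x': "\<iota> (c 0) * x' = (\<Sum>j=1..r. \<iota> (s j) * omega j)"
  proof -
    have "\<iota> (c 0) * x = (\<Sum>j=1..r. \<iota> (- c j) * omega j)"
      using rel by (simp add: iota_minus sum_negf eq_neg_iff_add_eq_0)
    also have "\<dots> = (\<Sum>j=1..r. \<iota> (c 0 * m j + s j) * omega j)"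
      by (simp only: m_def s_def mult_div_mod_eq)
    also have "\<dots> = \<iota> (c 0) * (\<Sum>j=1..r. \<iota> (m j) * omega j) + (\<Sum>j=1..r. \<iota> (s j) * omega j)"
      unfolding iota_add iota_mult by (simp add: algebra_simps sum.distrib sum_distrib_left)
    finally show ?thesis unfolding x'_def by (simp add: algebra_simps)
  qed
  have "x' = 0"
  proof (rule ccontr)
    assume "x' \<noteq> 0"
    \<comment> \<open>With \<open>k\<close> the last index of a nonzero remainder, \<open>x'\<close>
      is admissible for the \<open>k\<close>-th minimum. Each term of its expansion is too small,
      since remainders are smaller than \<open>c 0\<close> and \<open>omega j\<close> is at most
      \<open>omega k\<close> for \<open>j\<close> up to \<open>k\<close>.\<close>
    define I where "I = {j \<in> {1..r}. s j \<noteq> 0}"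
    have "I \<noteq> {}"
    proof
      assume "I = {}"
      then have "\<iota> (c 0) * x' = 0" unfolding x' by (auto simp: I_def)
      with c0 \<open>x' \<noteq> 0\<close> show False by simp
    qed
    moreover have "finite I" by (simp add: I_def)
    moreover define k where "k = Max I"
    ultimately have k: "k \<in> I" "\<And>j. j \<in> I \<Longrightarrow> j \<le> k" by auto
    then have kr: "k \<in> {1..r}" "s k \<noteq> 0" by (auto simp: I_def)
    have x'k: "\<iota> (c 0) * x' = (\<Sum>j=1..k. \<iota> (s j) * omega j)"
      unfolding x'
    proof (rule sum.mono_neutral_right)
      show "\<forall>j\<in>{1..r} - {1..k}. \<iota> (s j) * omega j = 0"
        using k(2) by (fastforce simp: I_def)
    qed (use kr in auto)
    have "A_independent \<iota> k (omega(k := x'))"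
      by (rule A_independent_exchange[OF ind[OF kr(1)] x'k c0]) (use kr in auto)
    moreover have "x' \<in> combinations r b"
      unfolding x'_def using x smb
      by (intro combinations_diff combinations_sum combinations_scale) (auto simp: lattice_SMB_def)
    ultimately have le: "absv (omega k) \<le> absv x'"
      using smb kr unfolding lattice_SMB_def by blast
    have "omega k \<noteq> 0"
    proof
      assume "omega k = 0"
      then have "(\<Sum>j=1..k. \<iota> (if j = k then 1 else 0) * omega j) = 0"
        by (intro sum.neutral) auto
      then have "\<forall>j\<in>{1..k}. (if j = k then 1 else 0) = (0::'q poly)"
        using ind[OF kr(1)] unfolding A_independent_def by (elim allE impE)
      then show False using kr(1) by (auto dest: bspec[of _ _ k])
    qed
    then have pos: "0 < absv (omega k)" by (simp add: less_le)
    have "absv (\<iota> (c 0) * x') < absv (\<iota> (c 0)) * absv (omega k)"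
      unfolding x'k
    proof (rule absv_sum_less)
      fix j assume j: "j \<in> {1..k}"
      have "absv (\<iota> (s j) * omega j) \<le> absv (\<iota> (s j)) * absv (omega k)"
        unfolding absv_mult using lattice_SMB_mono[OF smb, of j k] j kr by (intro mult_left_mono) auto
      also have "\<dots> < absv (\<iota> (c 0)) * absv (omega k)"
        using absv_iota_mod_less[OF c0] pos by (intro mult_strict_right_mono) (simp_all add: s_def del: poly_mod_minus_left)
      finally show "absv (\<iota> (s j) * omega j) < absv (\<iota> (c 0)) * absv (omega k)" .
    qed (use pos c0 in \<open>auto simp: less_le\<close>)
    then have "absv x' < absv (omega k)"
      unfolding absv_mult by (metis absv_nonneg mult_less_cancel_left_disj not_less)
    with le show False by simp
  qed
  then show thesis using that[of m] by (simp add: x'_def)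
qed

section \<open>Separability of torsion points\<close>

lemma of_nat_card_q: "of_nat CARD('q) = (0::'c)"
proof -
  \<comment> \<open>Translation by 1 permutes the finite field, so summing 1 over all its elements
    gives 0.\<close>
  have "(\<Sum>x\<in>UNIV. x + 1) = (\<Sum>x\<in>UNIV. x :: 'q)"
    by (rule sum.reindex_bij_witness[of _ "\<lambda>x. x - 1" "\<lambda>x. x + 1"]) auto
  then have "of_nat CARD('q) = (0::'q)" by (simp add: sum.distrib)
  then have "of_nat CARD('q) = (0::'q poly)" by (simp add: of_nat_poly)
  moreover have "\<iota> (of_nat k) = of_nat k" for k
    by (induction k) (auto simp: iota_add)
  ultimately show ?thesis by (metis iota_zero)
qed

text \<open>The exponents other than 1 are powers of \<open>CARD('q)\<close>, which is zero in
  \<open>'c\<close>, so only the linear term survives differentiation.\<close>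

lemma pderiv_Fq_linear:
  fixes p :: "'c poly"
  assumes "p \<in> Fq_linear_polys TYPE('q) K"
  shows "pderiv p = [:coeff p 1:]"
proof (rule poly_eqI)
  fix i
  have *: "coeff p j = 0" if "\<And>k. j \<noteq> CARD('q) ^ k" for j
    using assms that by (auto simp: Fq_linear_polys_def)
  show "coeff (pderiv p) i = coeff [:coeff p 1:] i"
  proof (cases i)
    case (Suc l)
    show ?thesis
    proof (cases "\<exists>k. Suc i = CARD('q) ^ k")
      case True
      then obtain k where k: "Suc i = CARD('q) ^ k" by blast
      with Suc have "k \<noteq> 0" by (intro notI) simp
      then have "of_nat (Suc i) = (0::'c)"
        unfolding k of_nat_power by (simp add: of_nat_card_q)
      then show ?thesis using Suc by (simp add: coeff_pderiv del: of_nat_Suc)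
    next
      case False
      then show ?thesis using * Suc by (simp add: coeff_pderiv)
    qed
  qed (simp add: coeff_pderiv)
qed

text \<open>The linear coefficient is the derivative at 0. All these polynomials fix 0, so the chain
  rule makes it multiplicative; it agrees with \<open>\<iota>\<close> on constants and on
  \<open>t\<close>, hence everywhere.\<close>

lemma drinfeld_module_linear_coeff:
  assumes dm: "drinfeld_module \<iota> K r \<phi>"
  shows "coeff (\<phi> a) 1 = \<iota> a"
proof -
  have lin: "\<phi> a \<in> Fq_linear_polys TYPE('q) K" and add: "\<phi> (a + b) = \<phi> a + \<phi> b"
    and comp: "\<phi> (a * b) = \<phi> a \<circ>\<^sub>p \<phi> b" and const: "\<phi> [:c:] = [:0, \<iota> [:c:]:]" for a b c
    using dm by (auto simp: drinfeld_module_def)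
  have zero: "poly (\<phi> a) 0 = 0" for a
    using lin[of a] by (auto simp: Fq_linear_polys_def poly_0_coeff_0)
  have deriv: "coeff p 1 = poly (pderiv p) 0" for p :: "'c poly"
    by (simp add: poly_0_coeff_0 coeff_pderiv)
  have mult: "coeff (\<phi> (a * b)) 1 = coeff (\<phi> a) 1 * coeff (\<phi> b) 1" for a b
    unfolding deriv comp by (simp add: pderiv_pcompose poly_pcompose zero)
  obtain g where g: "\<phi> [:0, 1:] = [:0, \<iota> [:0, 1:]:] + (\<Sum>i=1..r. monom (g i) (CARD('q) ^ i))"
    using dm unfolding drinfeld_module_def by blast
  have t: "coeff (\<phi> [:0, 1:]) 1 = \<iota> [:0, 1:]"
    unfolding g using card_q_gt_1 by (auto simp: coeff_sum intro!: sum.neutral)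
  show ?thesis
  proof (induction a)
    case 0
    show ?case using const[of 0] by simp
  next
    case (pCons c a)
    have "pCons c a = [:c:] + [:0, 1:] * a" by simp
    then show ?case
      by (simp only: add coeff_add mult t pCons.IH const iota_add iota_mult) simp
  qed
qed

text \<open>The derivative of \<open>\<phi> m\<close> is the nonzero constant
  \<open>\<iota> m\<close>, so every root in \<open>'c\<close> already lies in the separable
  closure.\<close>

lemma drinfeld_torsion_separable:
  assumes "drinfeld_module \<iota> K r \<phi>" and "m \<noteq> 0" and "poly (\<phi> m) x = 0"
  shows "x \<in> torsion K \<phi> m"
proof -
  have lin: "\<phi> m \<in> Fq_linear_polys TYPE('q) K"
    using assms(1) by (auto simp: drinfeld_module_def)
  have "pderiv (\<phi> m) = [:\<iota> m:]"
    using pderiv_Fq_linear[OF lin] drinfeld_module_linear_coeff[OF assms(1)] by simp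
  then have "coprime (\<phi> m) (pderiv (\<phi> m))"
    using \<open>m \<noteq> 0\<close> by (intro is_unit_right_imp_coprime) (simp add: is_unit_const_poly_iff dvd_field_iff)
  moreover have "\<phi> m \<in> poly_over K"
    using lin by (simp add: Fq_linear_polys_def)
  ultimately show ?thesis
    using assms(3) unfolding torsion_def separable_over_def by blast
qed

end

section \<open>Passage from the lattice to torsion points and their valuations\<close>

lemma valuation_of_absv_antimono:
  assumes "valuation_of_absv w" and "absv x \<le> absv y"
  shows "w y \<le> w x"
proof (cases "x = 0")
  case True
  then show ?thesis using assms(1) by (simp add: valuation_of_absv_def)
next
  case False
  then have "0 < absv x" by (simp add: less_le)
  with assms(2) have "y \<noteq> 0" by auto
  with False \<open>0 < absv x\<close> show ?thesis
    using assms unfolding valuation_of_absv_def by auto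
qed

theorem theorem3p1:
  fixes \<iota> :: "'q::{field,finite} poly \<Rightarrow> 'c::{nonarch_field,complete_space}"
    and F K :: "'c set" and w :: "'c \<Rightarrow> ereal"
    and r :: nat and \<phi> :: "'q poly \<Rightarrow> 'c poly"
    and \<Lambda> :: "'c set" and e\<^sub>\<phi> :: "'c \<Rightarrow> 'c" and omega :: "nat \<Rightarrow> 'c"
    and u :: "'q poly" and n :: nat
  assumes "A_inclusion \<iota>"
    and "finite_extension_of_Fqt \<iota> F"
    and "infinite_prime \<iota> F w"
    and "valuation_of_absv w"
    and "K = closure F"
    and "completed_algebraic_closure K"
    and "drinfeld_module \<iota> K r \<phi>"
    and "uniformization \<iota> K r \<phi> \<Lambda> e\<^sub>\<phi>"
    and "lattice_SMB \<iota> \<Lambda> r omega"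
    and "finite_prime u"
    and "n > 0"
  shows "torsion_SMB K w r \<phi> (u ^ n) (\<lambda>i. e\<^sub>\<phi> (omega i / \<iota> (u ^ n)))"
proof -
  interpret A_embedding \<iota> by unfold_locales (rule assms(1))
  define m where "m = u ^ n"
  define l where "l i = e\<^sub>\<phi> (omega i / \<iota> m)" for i
  have m0: "m \<noteq> 0" and not_unit: "\<not> m dvd 1"
    using assms(10,11) by (auto simp: m_def finite_prime_def irreducible_def is_unit_power_iff)
  have m_pos: "0 < absv (\<iota> m)" using absv_iota_ge_1[OF m0] by simp
  have r: "1 \<le> r" using assms(7) by (simp add: drinfeld_module_def)
  obtain b where b: "\<Lambda> = combinations r b"
    using assms(8) unfolding uniformization_def A_lattice_def combinations_def by blast
  have e: "is_lattice_exponential \<Lambda> e\<^sub>\<phi>" and surj: "surj e\<^sub>\<phi>"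
    and ker: "\<And>z. e\<^sub>\<phi> z = 0 \<longleftrightarrow> z \<in> \<Lambda>"
    and equiv: "\<And>a z. poly (\<phi> a) (e\<^sub>\<phi> z) = e\<^sub>\<phi> (\<iota> a * z)"
    using assms(8) unfolding uniformization_def by auto
  have e_add: "e\<^sub>\<phi> (x + y) = e\<^sub>\<phi> x + e\<^sub>\<phi> y" for x y
    using lattice_exponential_additive e unfolding b by blast
  have e_0: "e\<^sub>\<phi> 0 = 0" using e_add[of 0 0] by (metis add_0_right add_cancel_right_right)
  have e_sum: "e\<^sub>\<phi> (\<Sum>i\<in>I. f i) = (\<Sum>i\<in>I. e\<^sub>\<phi> (f i))" for I :: "nat set" and f
    by (induction I rule: infinite_finite_induct) (auto simp: e_add e_0)
  have smb: "lattice_SMB \<iota> (combinations r b) r omega" using assms(9) b by simp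
  have omega: "omega i \<in> \<Lambda>" "A_independent \<iota> i omega" if "i \<in> {1..r}" for i
    using smb that by (auto simp: lattice_SMB_def b)
  \<comment> \<open>This turns relations between torsion points into membership in the lattice, the
    kernel of the exponential.\<close>
  have combination: "(\<Sum>j\<in>J. poly (\<phi> (a j)) (l j)) = e\<^sub>\<phi> ((\<Sum>j\<in>J. \<iota> (a j) * omega j) / \<iota> m)" for J a
    by (simp add: l_def equiv e_sum sum_divide_distrib)
  show ?thesis
    unfolding torsion_SMB_def m_def[symmetric] l_def[symmetric]
  proof (intro ballI conjI impI)
    fix i assume i: "i \<in> {1..r}"
    show "l i \<in> torsion K \<phi> m"
    proof (rule drinfeld_torsion_separable[OF assms(7) m0])
      show "poly (\<phi> m) (l i) = 0"
        using omega(1)[OF i] m0 by (simp add: l_def equiv ker)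
    qed
    show "quotient_independent \<phi> m i l"
      unfolding quotient_independent_def
    proof (intro allI impI)
      fix a assume "(\<Sum>j=1..i. poly (\<phi> (a j)) (l j)) = 0"
      then have "(\<Sum>j=1..i. \<iota> (a j) * omega j) / \<iota> m \<in> combinations r b"
        by (simp add: combination ker b)
      then obtain c where c: "(\<Sum>j=1..i. \<iota> (a j) * omega j) / \<iota> m = (\<Sum>j=1..r. \<iota> (c j) * omega j)"
        using lattice_SMB_generates[OF smb r] by blast
      \<comment> \<open>Padding with zeros up to \<open>r\<close> allows comparison of coefficients
        with the full expansion of the lattice vector.\<close>
      define a' where "a' j = (if j \<le> i then a j else 0)" for j
      have "(\<Sum>j=1..i. \<iota> (a j) * omega j) = (\<Sum>j=1..r. \<iota> (a' j) * omega j)"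
        using i by (intro sum.mono_neutral_cong_left) (auto simp: a'_def)
      then have "(\<Sum>j=1..r. \<iota> (a' j - m * c j) * omega j) = 0"
        using c m0 by (simp add: iota_diff iota_mult left_diff_distrib sum_subtractf sum_distrib_left
            mult.assoc field_simps)
      then have "\<forall>j\<in>{1..r}. a' j = m * c j"
        using omega(2)[of r] r unfolding A_independent_def by auto
      then show "\<forall>j\<in>{1..i}. m dvd a j"
        using i by (auto simp: a'_def split: if_splits)
    qed
    fix x assume x: "x \<in> torsion K \<phi> m" and x_ind: "quotient_independent \<phi> m i (l(i := x))"
    obtain z0 where z0: "x = e\<^sub>\<phi> z0" using surj by (metis surjD)
    have "e\<^sub>\<phi> (\<iota> m * z0) = 0" using x by (simp add: torsion_def z0 equiv)
    then obtain a where a: "\<iota> m * z0 = (\<Sum>j=1..r. \<iota> (a j) * omega j)"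
      using lattice_SMB_generates[OF smb r] by (metis ker b)
    \<comment> \<open>Reducing the coefficients modulo \<open>m\<close> changes \<open>z0\<close>
      only by a lattice vector, and makes the representative as short as possible.\<close>
    define s where "s j = a j mod m" for j
    define z where "z = (\<Sum>j=1..r. \<iota> (s j) * omega j) / \<iota> m"
    have mz: "\<iota> m * z = (\<Sum>j=1..r. \<iota> (s j) * omega j)"
      using m0 by (simp add: z_def)
    have "\<iota> m * z0 = (\<Sum>j=1..r. \<iota> (m * (a j div m) + s j) * omega j)"
      unfolding a by (simp add: s_def)
    also have "\<dots> = \<iota> m * ((\<Sum>j=1..r. \<iota> (a j div m) * omega j) + z)"
      unfolding iota_add iota_mult distrib_left mz
      by (simp add: algebra_simps sum.distrib sum_distrib_left)
    finally have "z0 = (\<Sum>j=1..r. \<iota> (a j div m) * omega j) + z"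
      using m0 by simp
    moreover have "(\<Sum>j=1..r. \<iota> (a j div m) * omega j) \<in> \<Lambda>"
      using omega(1) unfolding b by (intro combinations_sum combinations_scale) auto
    ultimately have xz: "x = e\<^sub>\<phi> z" by (simp add: z0 e_add ker)
    have closest: "absv z \<le> absv (z - \<mu>)" if \<mu>: "\<mu> \<in> \<Lambda>" for \<mu>
    proof -
      obtain c where c: "\<mu> = (\<Sum>j=1..r. \<iota> (c j) * omega j)"
        using lattice_SMB_generates[OF smb r] \<mu> b by blast
      have eq: "\<iota> m * (z - \<mu>) = (\<Sum>j=1..r. \<iota> (s j - m * c j) * omega j)"
        unfolding right_diff_distrib mz c iota_diff iota_mult
        by (simp add: algebra_simps sum_subtractf sum_distrib_left)
      have "absv (\<iota> m * z) \<le> absv (\<iota> m * (z - \<mu>))"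
        unfolding mz
      proof (rule absv_sum_le)
        fix j assume j: "j \<in> {1..r}"
        \<comment> \<open>\<open>s j\<close> is the remainder of \<open>s j - m * c j\<close> modulo
          \<open>m\<close>, so its degree is no larger. If that difference is 0, then
          \<open>s j\<close> is a reduced multiple of \<open>m\<close>, hence 0.\<close>
        have "absv (\<iota> (s j)) \<le> absv (\<iota> (s j - m * c j))"
        proof (cases "s j - m * c j = 0")
          case True
          then have "s j = m * c j" by simp
          then have "s j = 0" unfolding s_def by (metis mod_mod_trivial mod_mult_self1_is_0)
          then show ?thesis by simp
        next
          case False
          have "(s j - m * c j) mod m = s j"
            by (simp add: s_def mod_diff_eq[symmetric])
          then have "degree (s j) \<le> degree (s j - m * c j)"
            using degree_mod_le[of "s j - m * c j" m] by simp
          with False show ?thesis by (intro absv_iota_mono)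
        qed
        then have "absv (\<iota> (s j) * omega j) \<le> absv (\<iota> (s j - m * c j) * omega j)"
          unfolding absv_mult by (intro mult_right_mono) auto
        also have "\<dots> \<le> absv (\<iota> m * (z - \<mu>))"
          unfolding eq by (rule lattice_SMB_orthogonal[OF smb j])
        finally show "absv (\<iota> (s j) * omega j) \<le> absv (\<iota> m * (z - \<mu>))" .
      qed simp
      then show ?thesis using m_pos by (simp add: absv_mult)
    qed
    have "\<exists>j\<in>{i..r}. s j \<noteq> 0"
    proof (rule ccontr)
      assume none: "\<not> (\<exists>j\<in>{i..r}. s j \<noteq> 0)"
      \<comment> \<open>Otherwise \<open>x\<close> would be a combination of the earlier
        \<open>l j\<close>; moving it to the other side gives a relation with the unit -1 at index
        \<open>i\<close>.\<close>
      define c where "c j = (if j = i then - 1 else s j)" for j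
      have "(\<Sum>j=1..r. \<iota> (s j) * omega j) = (\<Sum>j=1..<i. \<iota> (s j) * omega j)"
        using none i by (intro sum.mono_neutral_right) auto
      then have sum_x: "(\<Sum>j=1..<i. poly (\<phi> (s j)) (l j)) = x"
        by (simp add: combination xz z_def)
      have "(\<Sum>j=1..i. poly (\<phi> (c j)) ((l(i := x)) j)) =
          poly (\<phi> (- 1)) x + (\<Sum>j=1..<i. poly (\<phi> (s j)) (l j))"
        using i by (auto simp: sum.last_plus c_def intro!: sum.cong)
      also have "\<dots> = e\<^sub>\<phi> (- z) + e\<^sub>\<phi> z"
        unfolding sum_x by (simp add: xz equiv iota_minus)
      also have "\<dots> = 0" using e_add[of "- z" z] e_0 by simp
      finally have "m dvd c i"
        using x_ind i unfolding quotient_independent_def by auto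
      with not_unit show False by (simp add: c_def)
    qed
    then obtain j where j: "j \<in> {i..r}" "s j \<noteq> 0" by blast
    \<comment> \<open>A nonzero polynomial has absolute value at least 1, and orthogonality prevents
      the \<open>j\<close>-th term from being cancelled in \<open>\<iota> m * z\<close>.\<close>
    have "absv (omega i) \<le> 1 * absv (omega j)"
      using lattice_SMB_mono[OF smb, of i j] i j by simp
    also have "\<dots> \<le> absv (\<iota> (s j)) * absv (omega j)"
      using absv_iota_ge_1[OF j(2)] by (intro mult_right_mono) auto
    also have "\<dots> \<le> absv (\<iota> m * z)"
      unfolding mz absv_mult[symmetric] using i j by (intro lattice_SMB_orthogonal[OF smb]) auto
    finally have "absv (omega i / \<iota> m) \<le> absv z"
      using m_pos by (simp add: absv_divide absv_mult field_simps)
    then have "absv (l i) \<le> absv x"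
      unfolding l_def xz by (intro lattice_exponential_mono[OF e] closest)
    then show "w x \<le> w (l i)"
      by (rule valuation_of_absv_antimono[OF assms(4)])
  qed
qed

end
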